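(* Let $c$ be an indeterminate (or any scalar in a field of characteristic $0$) and let $(a_n)_{n\ge0}$ be defined by $$f(x)=\sum_{n\ge0}a_n\,\frac{x^n}{n!}=e^{cx+x^2/2},\qquad\text{i.e.}\qquad a_n=\sum_{j\ge 0}\binom{n}{2j}(2j-1)!!\,c^{\,n-2j}.$$ Then for all $n\ge 1$, $$\ddot H_n(f)=\det(a_{2i+j})_{0\le i,j\le n-1}=(2c)^{\binom n2}\prod_{k=1}^{n-1}k!.$$
   Context: For a power series $f(x)=\sum_{n\ge0}a_nx^n/n!$, the dilated Hankel determinant is $\ddot H_n(f)=\det(a_{2i+j})_{0\le i,j\le n-1}$. Conventions: $m!!=m(m-2)(m-4)\cdots$ down to $1$ or $2$, with $0!!=(-1)!!=1$; empty products equal $1$. *)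

theory Defs
  imports
    "HOL-Computational_Algebra.Formal_Power_Series"
    "Jordan_Normal_Form.Determinant"
begin

text \<open>The argument is an integer because the value at \<open>-1\<close> is needed, where it is \<open>1\<close>
  (an empty product); values at arguments below \<open>-1\<close> are irrelevant.\<close>

function double_fact :: "int \<Rightarrow> nat" where
  "double_fact m = (if m \<le> 0 then 1 else nat m * double_fact (m - 2))"
  by auto
termination by (relation "measure nat") auto

text \<open>The recursion equation loops as a rewrite rule.\<close>
declare double_fact.simps [simp del]

text \<open>Since \<open>f = (\<Sum>n. a n * x ^ n / n!)\<close>, the coefficient \<open>a n\<close> is \<open>n!\<close> times the ordinary one.\<close>

definition egf_coeff :: "'a::field_char_0 fps \<Rightarrow> nat \<Rightarrow> 'a" where
  "egf_coeff f n = fact n * fps_nth f n"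

definition dilated_hankel_det :: "nat \<Rightarrow> 'a::field_char_0 fps \<Rightarrow> 'a" where
  "dilated_hankel_det n f = det (mat n n (\<lambda>(i, j). egf_coeff f (2 * i + j)))"

end

theory Submission imports Defs begin

no_notation vec_index (infixl "$" 100)
unbundle fps_syntax

text \<open>The exponential generating function of row \<open>i\<close> is the derivative \<open>f\<^bsup>(2i)\<^esup>\<close>. Put
  \<open>w = 2cx + x\<^sup>2\<close>. Since \<open>f' = (c + x) f\<close> and \<open>(c + x)\<^sup>2 = c\<^sup>2 + w\<close>, two derivatives turn \<open>f p(w)\<close>
  into \<open>f q(w)\<close> with \<open>q = (c\<^sup>2 + y)(p + 4p' + 4p'') + p + 2p'\<close>, so \<open>f\<^bsup>(2i)\<^esup> = f P\<^sub>i(w)\<close> with \<open>P\<^sub>i\<close>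
  monic of degree \<open>i\<close>. Expanding \<open>P\<^sub>i\<close> writes the matrix as the product of a lower unitriangular
  matrix and the matrix whose row \<open>k\<close> has generating function \<open>f w\<^sup>k = (2c)\<^sup>k x\<^sup>k + \<dots>\<close>, which is
  upper triangular.\<close>

section \<open>Derivatives, linear differential equations and composition of power series\<close>

lemma egf_coeff_fps_deriv_power:
  "egf_coeff ((fps_deriv ^^ m) f) j = egf_coeff f (m + j)"
proof (induction m arbitrary: j)
  case (Suc m)
  have "egf_coeff ((fps_deriv ^^ Suc m) f) j = egf_coeff ((fps_deriv ^^ m) f) (Suc j)"
    by (simp add: egf_coeff_def algebra_simps)
  then show ?case by (simp add: Suc.IH)
qed simp

text \<open>Comparing coefficients of x^m expresses (m+1) times the coefficient of index m+1 through
  those of index at most m; in characteristic 0 the factor m+1 can be cancelled.\<close>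

lemma fps_linear_ode_unique:
  fixes f g :: "'a::field_char_0 fps"
  assumes "fps_deriv f = h * f" "fps_deriv g = h * g" "f $ 0 = g $ 0"
  shows "f = g"
proof -
  have "f $ n = g $ n" for n
  proof (induction n rule: less_induct)
    case (less n)
    show ?case
    proof (cases n)
      case (Suc m)
      have "fps_deriv f $ m = fps_deriv g $ m"
        unfolding assms fps_mult_nth by (intro sum.cong) (auto simp: less Suc)
      moreover have "of_nat (Suc m) \<noteq> (0::'a)" by (rule of_nat_neq_0)
      ultimately show ?thesis by (simp add: Suc del: of_nat_Suc)
    qed (use assms in simp)
  qed
  then show ?thesis by (simp add: fps_eq_iff)
qed

text \<open>As \<open>w\<close> has no constant term, \<open>w ^ k\<close> starts in degree k or
  later, so the composition can be cut off at any \<open>n > j\<close>. One bound \<open>n\<close>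
  serving all \<open>j < n\<close> is what lets the sum be read as an entry of a product of n by n
  matrices.\<close>

lemma fps_mult_compose_nth:
  fixes f p w :: "'a::field_char_0 fps"
  assumes "w $ 0 = 0" "j < n"
  shows "(f * (p oo w)) $ j = (\<Sum>k<n. p $ k * (f * w ^ k) $ j)"
proof -
  have compose: "(p oo w) $ m = (\<Sum>k<n. p $ k * (w ^ k) $ m)" if "m < n" for m
    unfolding fps_compose_nth
    by (rule sum.mono_neutral_left) (use that assms in \<open>auto simp: startsby_zero_power_prefix\<close>)
  have "(f * (p oo w)) $ j = (\<Sum>i=0..j. \<Sum>k<n. f $ i * (p $ k * (w ^ k) $ (j - i)))"
    unfolding fps_mult_nth using assms by (intro sum.cong) (auto simp: compose sum_distrib_left)
  also have "\<dots> = (\<Sum>k<n. \<Sum>i=0..j. f $ i * (p $ k * (w ^ k) $ (j - i)))"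
    by (rule sum.swap)
  also have "\<dots> = (\<Sum>k<n. p $ k * (f * w ^ k) $ j)"
    unfolding fps_mult_nth by (simp add: sum_distrib_left mult_ac)
  finally show ?thesis .
qed

lemma deriv_exp_quadratic:
  fixes c :: "'a::field_char_0"
  assumes "f = fps_exp 1 oo (fps_const c * fps_X + fps_const (1 / 2) * fps_X ^ 2)"
  shows "fps_deriv f = (fps_const c + fps_X) * f"
proof -
  have "fps_const (1 / 2) * (2 * fps_X) = (fps_X :: 'a fps)"
    by (simp add: fps_eq_iff numeral_fps_const fps_mult_left_const_nth)
  then show ?thesis
    unfolding assms
    by (subst fps_compose_deriv) (auto simp: power2_eq_square mult_ac fps_deriv_power)
qed

section \<open>Even derivatives of \<open>f\<close> and the triangular factorization\<close>

context
  fixes c :: "'a::field_char_0" and f w :: "'a fps"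
  assumes f_deriv: "fps_deriv f = (fps_const c + fps_X) * f"
    and f_0: "f $ 0 = 1"
    and w_def: "w = fps_const (2 * c) * fps_X + fps_X ^ 2"
begin

text \<open>Here \<open>fps_X\<close> is the variable y for which \<open>w\<close> is substituted
  later, not the variable x of \<open>f\<close>. Under this substitution the factor
  \<open>fps_X + fps_const (c\<^sup>2)\<close> becomes (c + x)^2.\<close>

definition second_deriv_op :: "'a fps \<Rightarrow> 'a fps" where
  "second_deriv_op p =
     (fps_X + fps_const (c\<^sup>2)) * (p + 4 * fps_deriv p + 4 * fps_deriv (fps_deriv p))
       + p + 2 * fps_deriv p"

lemma w_0: "w $ 0 = 0"
  by (simp add: w_def)

text \<open>With u = c + x one has f' = u f and w' = 2u, so the first derivative is f u (p +
  2p')(w). Differentiating again produces u^2 and u' = 1, and u^2 = w + c^2 is once more a function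
  of \<open>w\<close>. A single derivative leaves a lone u, which is why derivatives are taken in
  pairs.\<close>

lemma second_deriv_mult_compose:
  "fps_deriv (fps_deriv (f * (p oo w))) = f * (second_deriv_op p oo w)"
proof -
  define u where "u = fps_const c + fps_X"
  have u_deriv: "fps_deriv u = 1" by (simp add: u_def)
  have c2: "fps_const (2 * c) = 2 * fps_const c" "fps_const (c\<^sup>2) = fps_const c * fps_const c"
    by (simp_all only: numeral_fps_const fps_const_mult power2_eq_square)
  have w_eq: "w = 2 * fps_const c * fps_X + fps_X * fps_X"
    by (simp only: w_def c2 power2_eq_square)
  have w_deriv: "fps_deriv w = 2 * u"
    by (simp add: w_eq u_def algebra_simps)
  have u_sq: "w + fps_const (c\<^sup>2) = u * u"
    unfolding w_eq u_def c2 by (simp add: algebra_simps)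
  have deriv_compose: "fps_deriv (q oo w) = (fps_deriv q oo w) * (2 * u)" for q :: "'a fps"
    by (simp add: fps_compose_deriv w_0 w_deriv)
  have compose_numeral: "numeral k oo w = numeral k" for k
    by (simp add: numeral_fps_const)
  have op: "second_deriv_op p oo w =
     u * u * ((p oo w) + 4 * (fps_deriv p oo w) + 4 * (fps_deriv (fps_deriv p) oo w))
       + (p oo w) + 2 * (fps_deriv p oo w)"
    unfolding second_deriv_op_def u_sq[symmetric]
    by (simp add: fps_compose_add_distrib fps_compose_mult_distrib w_0 compose_numeral)
  have f': "fps_deriv f = u * f" using f_deriv by (simp add: u_def)
  show ?thesis
    unfolding op by (simp add: f' deriv_compose u_deriv) (simp add: algebra_simps)
qed

lemma even_deriv_eq:
  "(fps_deriv ^^ (2 * i)) f = f * ((second_deriv_op ^^ i) 1 oo w)"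
proof (induction i)
  case (Suc i)
  have "(fps_deriv ^^ (2 * Suc i)) f = fps_deriv (fps_deriv ((fps_deriv ^^ (2 * i)) f))"
    by simp
  then show ?case by (simp only: Suc second_deriv_mult_compose funpow.simps o_apply)
qed simp

text \<open>Apart from the leading \<open>p $ k\<close>, every coefficient of \<open>p\<close> on
  the right has index above k. Hence the operator raises the degree of a polynomial by exactly one
  and keeps its leading coefficient.\<close>

lemma second_deriv_op_nth_Suc:
  "second_deriv_op p $ Suc k =
     p $ k + 4 * of_nat (Suc k) * p $ Suc k + 4 * of_nat (Suc k) * of_nat (Suc (Suc k)) * p $ Suc (Suc k)
     + c\<^sup>2 * (p $ Suc k + 4 * of_nat (Suc (Suc k)) * p $ Suc (Suc k)
       + 4 * of_nat (Suc (Suc k)) * of_nat (Suc (Suc (Suc k))) * p $ Suc (Suc (Suc k)))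
     + p $ Suc k + 2 * of_nat (Suc (Suc k)) * p $ Suc (Suc k)"
  by (simp add: second_deriv_op_def numeral_fps_const algebra_simps)

lemma second_deriv_op_power_unitriangular:
  "(second_deriv_op ^^ i) 1 $ i = 1" "k > i \<Longrightarrow> (second_deriv_op ^^ i) 1 $ k = 0"
proof -
  have "(second_deriv_op ^^ i) 1 $ i = 1 \<and> (\<forall>k>i. (second_deriv_op ^^ i) 1 $ k = 0)"
  proof (induction i)
    case (Suc i)
    have "(second_deriv_op ^^ Suc i) 1 $ k = 0" if k: "k > Suc i" for k
    proof -
      obtain m where "m > i" "k = Suc m" using k by (auto elim: Suc_lessE)
      then show ?thesis using Suc by (simp add: second_deriv_op_nth_Suc)
    qed
    then show ?case using Suc by (simp add: second_deriv_op_nth_Suc)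
  qed simp
  then show "(second_deriv_op ^^ i) 1 $ i = 1" "k > i \<Longrightarrow> (second_deriv_op ^^ i) 1 $ k = 0"
    by auto
qed

text \<open>Since w = x (2c + x), the series is x^k times a series with constant term
  (2c)^k.\<close>

lemma mult_w_power_nth:
  "(f * w ^ k) $ k = (2 * c) ^ k" "j < k \<Longrightarrow> (f * w ^ k) $ j = 0"
proof -
  have "w = fps_X * (fps_const (2 * c) + fps_X)"
    by (simp add: w_def power2_eq_square algebra_simps)
  then have eq: "f * w ^ k = fps_X ^ k * (f * (fps_const (2 * c) + fps_X) ^ k)"
    by (simp add: power_mult_distrib mult_ac)
  show "(f * w ^ k) $ k = (2 * c) ^ k"
    unfolding eq by (simp add: fps_X_power_mult_nth f_0 fps_nth_power_0)
  show "(f * w ^ k) $ j = 0" if "j < k"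
    unfolding eq using that by (simp add: fps_X_power_mult_nth)
qed

lemma dilated_hankel_det_eq:
  "dilated_hankel_det n f = (2 * c) ^ (n choose 2) * (\<Prod>k<n. fact k)"
proof -
  define A where "A = mat n n (\<lambda>(i, k). (second_deriv_op ^^ i) 1 $ k)"
  \<comment> \<open>The factor \<open>fact j\<close> passes from ordinary to exponential
    coefficients; placed in \<open>B\<close>, it leaves \<open>A\<close> unitriangular and makes the
    diagonal entries of \<open>B\<close> equal to k! (2c)^k.\<close>
  define B where "B = mat n n (\<lambda>(k, j). fact j * (f * w ^ k) $ j)"
  have "mat n n (\<lambda>(i, j). egf_coeff f (2 * i + j)) = A * B"
  proof (rule eq_matI)
    fix i j assume ij: "i < dim_row (A * B)" "j < dim_col (A * B)"
    then have lt: "i < n" "j < n" by (auto simp: A_def B_def)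
    have "egf_coeff f (2 * i + j) = fact j * (f * ((second_deriv_op ^^ i) 1 oo w)) $ j"
      using egf_coeff_fps_deriv_power[of "2 * i" f j]
      by (simp only: even_deriv_eq egf_coeff_def[of "_ * _"])
    also have "\<dots> = (\<Sum>k<n. (second_deriv_op ^^ i) 1 $ k * (fact j * (f * w ^ k) $ j))"
      by (simp add: fps_mult_compose_nth[OF w_0 \<open>j < n\<close>] sum_distrib_left mult_ac)
    also have "\<dots> = (A * B) $$ (i, j)"
      using lt by (simp add: A_def B_def scalar_prod_def atLeast0LessThan)
    finally show "mat n n (\<lambda>(i, j). egf_coeff f (2 * i + j)) $$ (i, j) = (A * B) $$ (i, j)"
      using lt by simp
  qed (auto simp: A_def B_def)
  moreover have carrier: "A \<in> carrier_mat n n" "B \<in> carrier_mat n n"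
    by (simp_all add: A_def B_def)
  moreover have "det A = 1"
  proof -
    have "det A = prod_list (diag_mat A)"
      by (rule det_lower_triangular[OF _ carrier(1)])
        (auto simp: A_def second_deriv_op_power_unitriangular)
    also have "diag_mat A = map (\<lambda>_. 1) [0..<n]"
      by (auto simp: diag_mat_def A_def second_deriv_op_power_unitriangular)
    finally show ?thesis by (simp add: map_replicate_const)
  qed
  moreover have "det B = (2 * c) ^ (n choose 2) * (\<Prod>k<n. fact k)"
  proof -
    have "det B = prod_list (diag_mat B)"
      by (rule det_upper_triangular[OF _ carrier(2)])
        (auto simp: B_def mult_w_power_nth)
    also have "diag_mat B = map (\<lambda>k. fact k * (2 * c) ^ k) [0..<n]"
      by (auto simp: diag_mat_def B_def mult_w_power_nth)
    also have "prod_list \<dots> = (\<Prod>k<n. fact k * (2 * c) ^ k)"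
      by (simp add: prod.distinct_set_conv_list[symmetric] atLeast0LessThan)
    also have "\<dots> = (\<Prod>k<n. fact k) * (2 * c) ^ (\<Sum>k<n. k)"
      by (simp add: prod.distrib power_sum)
    also have "(\<Sum>k<n. k) = n choose 2"
      by (induction n) (auto simp: numeral_2_eq_2)
    finally show ?thesis by (simp add: mult.commute)
  qed
  ultimately show ?thesis
    by (simp add: dilated_hankel_det_def det_mult)
qed

end

section \<open>The explicit formula for the coefficients\<close>

lemma double_fact_odd:
  "double_fact (2 * int j - 1) * (2 ^ j * fact j) = fact (2 * j)"
proof (induction j)
  case 0
  \<comment> \<open>This case rests on the convention that the double factorial of -1 is 1.\<close>
  show ?case by (simp add: double_fact.simps)
next
  case (Suc j)
  have "double_fact (2 * int (Suc j) - 1) = (2 * j + 1) * double_fact (2 * int j - 1)"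
    by (subst double_fact.simps) (simp add: nat_add_distrib nat_mult_distrib)
  then have "double_fact (2 * int (Suc j) - 1) * (2 ^ Suc j * fact (Suc j))
      = (2 * j + 1) * (2 * j + 2) * (double_fact (2 * int j - 1) * (2 ^ j * fact j))"
    by (simp add: algebra_simps)
  then show ?case unfolding Suc.IH by (simp add: algebra_simps)
qed

lemma sum_even_reindex:
  fixes g :: "nat \<Rightarrow> 'a::comm_monoid_add"
  assumes "\<And>i. odd i \<Longrightarrow> g i = 0"
  shows "(\<Sum>i=0..n. g i) = (\<Sum>j=0..n div 2. g (2 * j))"
proof -
  have even_image: "i \<in> (*) 2 ` {0..n div 2}" if "even i" "i \<le> n" for i
    using that by (auto elim!: evenE)
  have "(\<Sum>i=0..n. g i) = sum g ((*) 2 ` {0..n div 2})"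
  proof (rule sum.mono_neutral_right)
    show "\<forall>i\<in>{0..n} - (*) 2 ` {0..n div 2}. g i = 0"
      using assms even_image by (metis DiffE atLeastAtMost_iff)
  qed auto
  also have "\<dots> = (\<Sum>j=0..n div 2. g (2 * j))"
    by (simp add: sum.reindex inj_on_def)
  finally show ?thesis .
qed

text \<open>Both \<open>f\<close> and the product of exp(x^2/2) and exp(cx) solve the same linear
  differential equation with initial value 1, so they agree; the formula is then the Cauchy product
  of the two factors.\<close>

lemma egf_coeff_exp_quadratic:
  fixes c :: "'a::field_char_0"
  assumes deriv: "fps_deriv f = (fps_const c + fps_X) * f" and f_0: "f $ 0 = 1"
  shows "egf_coeff f n = (\<Sum>j = 0..n div 2.
      of_nat (n choose (2 * j)) * of_nat (double_fact (2 * int j - 1)) * c ^ (n - 2 * j))"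
proof -
  \<comment> \<open>This is exp(x^2/2), given by its coefficients so that the Cauchy product can be
    read off directly.\<close>
  define e :: "'a fps" where
    "e = Abs_fps (\<lambda>n. if even n then 1 / (2 ^ (n div 2) * fact (n div 2)) else 0)"
  have "fps_deriv e = fps_X * e"
  proof (rule fps_ext)
    fix n
    show "fps_deriv e $ n = (fps_X * e) $ n"
    proof (cases n)
      case (Suc m)
      show ?thesis
      proof (cases "even m")
        case True
        \<comment> \<open>With e_i the coefficients of \<open>e\<close>, the claim is (2k+2)
          e_{2k+2} = e_{2k}. Clearing denominators needs k+1 and 2k+2 to be nonzero in the
          field.\<close>
        then obtain k where "m = 2 * k" by (elim evenE)
        moreover have nz: "of_nat k + 1 \<noteq> (0::'a)"
          using of_nat_neq_0[of k, where 'a='a] by (simp add: add.commute)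
        moreover have "2 + of_nat k * 2 \<noteq> (0::'a)"
        proof -
          have "2 + of_nat k * 2 = 2 * (of_nat k + 1 :: 'a)" by simp
          then show ?thesis using nz by (simp only: mult_eq_0_iff) simp
        qed
        ultimately show ?thesis by (simp add: Suc e_def divide_simps) (simp add: algebra_simps)
      qed (simp add: Suc e_def)
    qed (simp add: e_def)
  qed
  then have "fps_deriv (e * fps_exp c) = (fps_const c + fps_X) * (e * fps_exp c)"
    by (simp add: algebra_simps)
  then have "f = e * fps_exp c"
    by (rule fps_linear_ode_unique[OF deriv]) (simp add: f_0 e_def)
  then have "egf_coeff f n = (\<Sum>i=0..n. fact n * (e $ i * (c ^ (n - i) / fact (n - i))))"
    by (simp add: egf_coeff_def fps_mult_nth sum_distrib_left)
  also have "\<dots> = (\<Sum>j=0..n div 2. fact n * (e $ (2 * j) * (c ^ (n - 2 * j) / fact (n - 2 * j))))"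
    by (rule sum_even_reindex) (simp add: e_def)
  also have "\<dots> = (\<Sum>j = 0..n div 2.
      of_nat (n choose (2 * j)) * of_nat (double_fact (2 * int j - 1)) * c ^ (n - 2 * j))"
  proof (rule sum.cong)
    fix j assume "j \<in> {0..n div 2}"
    then have "2 * j \<le> n" by auto
    \<comment> \<open>The denominator 2^j j! of the coefficient of \<open>e\<close> combines with
      the (2j)! in the binomial coefficient to give (2j-1)!!.\<close>
    have "of_nat (double_fact (2 * int j - 1)) * (2 ^ j * fact j) = (fact (2 * j) :: 'a)"
      using arg_cong[OF double_fact_odd[of j], of "of_nat :: nat \<Rightarrow> 'a"] by simp
    then have "of_nat (double_fact (2 * int j - 1)) = (fact (2 * j) / (2 ^ j * fact j) :: 'a)"
      by (simp add: field_simps)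
    then show "fact n * (e $ (2 * j) * (c ^ (n - 2 * j) / fact (n - 2 * j))) =
      of_nat (n choose (2 * j)) * of_nat (double_fact (2 * int j - 1)) * c ^ (n - 2 * j)"
      by (simp add: e_def binomial_fact[OF \<open>2 * j \<le> n\<close>])
  qed simp
  finally show ?thesis .
qed

theorem theorem5p1:
  fixes c :: "'a::field_char_0" and f :: "'a fps" and a :: "nat \<Rightarrow> 'a"
  assumes "f = Abs_fps (\<lambda>n. a n / fact n)"
    and "f = fps_compose (fps_exp 1) (fps_const c * fps_X + fps_const (1 / 2) * fps_X ^ 2)"
  shows "(\<forall>n. a n = (\<Sum>j = 0..n div 2.
             of_nat (n choose (2 * j)) * of_nat (double_fact (2 * int j - 1)) * c ^ (n - 2 * j))) \<and>
         (\<forall>n\<ge>1.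
             dilated_hankel_det n f = det (mat n n (\<lambda>(i, j). a (2 * i + j))) \<and>
             det (mat n n (\<lambda>(i, j). a (2 * i + j)))
               = (2 * c) ^ (n choose 2) * (\<Prod>k = 1..n - 1. fact k))"
proof -
  have a: "a n = egf_coeff f n" for n
    by (simp add: assms(1) egf_coeff_def)
  note deriv = deriv_exp_quadratic[OF assms(2)]
  have f_0: "f $ 0 = 1" by (simp add: assms(2))
  \<comment> \<open>The two ranges differ only in k = 0, where the factor is 0! = 1.\<close>
  have "(\<Prod>k<n. fact k) = (\<Prod>k=1..n - 1. fact k :: 'a)" if "n \<ge> 1" for n
    by (rule prod.mono_neutral_right) (use that in \<open>auto simp: not_le Suc_le_eq\<close>)
  then show ?thesis
    using dilated_hankel_det_eq[OF deriv f_0 refl] egf_coeff_exp_quadratic[OF deriv f_0]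
    by (simp add: a dilated_hankel_det_def)
qed

end
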